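(* Let $n\ge 1$. If $\phi$ is an existential first order sentence over the vocabulary $\{P_1,\ldots,P_n\}$ of $n$ unary predicates expressing the property that all Boolean combinations of the $n$ unary predicates are non-empty, then the size of $\phi$ is at least $(n+1)2^n$.
   Context: First order logic has equality; models have nonempty universe. An existential formula is one built from atomic formulas and negations of atomic formulas using only $\vee$, $\wedge$ and $\exists x_j$. The size $\mathrm{w}$ of a formula is defined by $\mathrm{w}(\phi)=1$ for atomic $\phi$, $\mathrm{w}(\neg\phi)=\mathrm{w}(\phi)$, $\mathrm{w}(\phi\vee\psi)=\mathrm{w}(\phi\wedge\psi)=\mathrm{w}(\phi)+\mathrm{w}(\psi)$, $\mathrm{w}(\exists x_j\phi)=\mathrm{w}(\phi)+1$. "All Boolean combinations are non-empty" in a $\{P_1,\ldots,P_n\}$-model means: for every $S\subseteq\{1,\ldots,n\}$ there is an element $x$ such that for each $i$, $P_i(x)$ holds iff $i\in S$. A sentence $\phi$ expresses a property if for every $\{P_1,\ldots,P_n\}$-model, $\phi$ is true in the model iff the model has the property. *)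

theory Defs
  imports Main
begin

text \<open>
  First order logic with equality over unary predicate symbols \<open>P\<^sub>i\<close> and variables \<open>x\<^sub>j\<close>,
  both indexed by natural numbers; \<open>Pred i j\<close> is \<open>P\<^sub>i(x\<^sub>j)\<close>. The universal quantifier is the
  usual abbreviation \<open>\<not>\<exists>\<not>\<close>.
\<close>

datatype fm =
    Pred nat nat
  | Eq nat nat
  | Neg fm
  | Or fm fm
  | And fm fm
  | Exists nat fm

fun preds :: "fm \<Rightarrow> nat set" where
  "preds (Pred i j) = {i}"
| "preds (Eq j k) = {}"
| "preds (Neg \<phi>) = preds \<phi>"
| "preds (Or \<phi> \<psi>) = preds \<phi> \<union> preds \<psi>"
| "preds (And \<phi> \<psi>) = preds \<phi> \<union> preds \<psi>"
| "preds (Exists j \<phi>) = preds \<phi>"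

fun free_vars :: "fm \<Rightarrow> nat set" where
  "free_vars (Pred i j) = {j}"
| "free_vars (Eq j k) = {j, k}"
| "free_vars (Neg \<phi>) = free_vars \<phi>"
| "free_vars (Or \<phi> \<psi>) = free_vars \<phi> \<union> free_vars \<psi>"
| "free_vars (And \<phi> \<psi>) = free_vars \<phi> \<union> free_vars \<psi>"
| "free_vars (Exists j \<phi>) = free_vars \<phi> - {j}"

definition sentence_over :: "nat set \<Rightarrow> fm \<Rightarrow> bool" where
  "sentence_over V \<phi> \<longleftrightarrow> preds \<phi> \<subseteq> V \<and> free_vars \<phi> = {}"

fun atomic :: "fm \<Rightarrow> bool" where
  "atomic (Pred i j) = True"
| "atomic (Eq j k) = True"
| "atomic _ = False"

inductive existential :: "fm \<Rightarrow> bool" where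
  "atomic \<phi> \<Longrightarrow> existential \<phi>"
| "atomic \<phi> \<Longrightarrow> existential (Neg \<phi>)"
| "existential \<phi> \<Longrightarrow> existential \<psi> \<Longrightarrow> existential (Or \<phi> \<psi>)"
| "existential \<phi> \<Longrightarrow> existential \<psi> \<Longrightarrow> existential (And \<phi> \<psi>)"
| "existential \<phi> \<Longrightarrow> existential (Exists j \<phi>)"

fun w :: "fm \<Rightarrow> nat" where
  "w (Pred i j) = 1"
| "w (Eq j k) = 1"
| "w (Neg \<phi>) = w \<phi>"
| "w (Or \<phi> \<psi>) = w \<phi> + w \<psi>"
| "w (And \<phi> \<psi>) = w \<phi> + w \<psi>"
| "w (Exists j \<phi>) = w \<phi> + 1"

datatype 'a model = Model (universe: "'a set") (interp: "nat \<Rightarrow> 'a set")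

text \<open>For a vocabulary \<open>V\<close>, only the values of \<open>interp\<close> on \<open>V\<close> carry meaning.\<close>

definition is_model :: "nat set \<Rightarrow> 'a model \<Rightarrow> bool" where
  "is_model V M \<longleftrightarrow> universe M \<noteq> {} \<and> (\<forall>i\<in>V. interp M i \<subseteq> universe M)"

fun sat :: "'a model \<Rightarrow> (nat \<Rightarrow> 'a) \<Rightarrow> fm \<Rightarrow> bool" where
  "sat M s (Pred i j) \<longleftrightarrow> s j \<in> interp M i"
| "sat M s (Eq j k) \<longleftrightarrow> s j = s k"
| "sat M s (Neg \<phi>) \<longleftrightarrow> \<not> sat M s \<phi>"
| "sat M s (Or \<phi> \<psi>) \<longleftrightarrow> sat M s \<phi> \<or> sat M s \<psi>"
| "sat M s (And \<phi> \<psi>) \<longleftrightarrow> sat M s \<phi> \<and> sat M s \<psi>"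
| "sat M s (Exists j \<phi>) \<longleftrightarrow> (\<exists>a\<in>universe M. sat M (s(j := a)) \<phi>)"

text \<open>For sentences the choice of the assignment is irrelevant.\<close>

definition true_in :: "'a model \<Rightarrow> fm \<Rightarrow> bool" where
  "true_in M \<phi> \<longleftrightarrow> (\<forall>s. range s \<subseteq> universe M \<longrightarrow> sat M s \<phi>)"

text \<open>
  HOL cannot quantify over types inside a formula, so the models range over those whose universe
  is a nonempty subset of \<open>'a\<close>. Restricting the models only weakens this condition, hence a
  statement assuming it for an arbitrary infinite type \<open>'a\<close> is at least as strong as one
  assuming it for all models.
\<close>

definition expresses :: "nat set \<Rightarrow> fm \<Rightarrow> ('a model \<Rightarrow> bool) \<Rightarrow> bool" where
  "expresses V \<phi> Q \<longleftrightarrow> (\<forall>M. is_model V M \<longrightarrow> (true_in M \<phi> \<longleftrightarrow> Q M))"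

definition all_boolean_combinations_nonempty :: "nat \<Rightarrow> 'a model \<Rightarrow> bool" where
  "all_boolean_combinations_nonempty n M \<longleftrightarrow>
    (\<forall>S\<subseteq>{1..n}. \<exists>x\<in>universe M. \<forall>i\<in>{1..n}. x \<in> interp M i \<longleftrightarrow> i \<in> S)"

end

theory Submission
  imports Defs
begin

text \<open>
  Evaluating an existential sentence in a model in which every Boolean combination has exactly one
  element, fix the chosen witnesses and disjuncts. The literals met on the way inspect some facts
  \<open>P\<^sub>i(a)\<close>, at most one per atomic subformula, about elements \<open>a\<close> chosen by quantifiers, and the
  sentence remains true when all other facts are changed. Changing a single fact \<open>P\<^sub>i(a)\<close> makes the
  Boolean combination realised by \<open>a\<close> empty, so all \<open>n 2\<^sup>n\<close> facts are inspected, hence also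
  all \<open>2\<^sup>n\<close> elements are chosen by quantifiers.
\<close>

lemma sat_cong_free_vars:
  assumes "\<And>x. x \<in> free_vars \<phi> \<Longrightarrow> s x = t x"
  shows "sat M s \<phi> \<longleftrightarrow> sat M t \<phi>"
  using assms
proof (induction \<phi> arbitrary: s t)
  case (Neg \<phi>)
  have "sat M s \<phi> = sat M t \<phi>"
    using Neg.prems by (intro Neg.IH) auto
  then show ?case by simp
next
  case (Or \<phi> \<psi>)
  have "sat M s \<phi> = sat M t \<phi>" "sat M s \<psi> = sat M t \<psi>"
    using Or.prems by (auto intro!: Or.IH)
  then show ?case by simp
next
  case (And \<phi> \<psi>)
  have "sat M s \<phi> = sat M t \<phi>" "sat M s \<psi> = sat M t \<psi>"
    using And.prems by (auto intro!: And.IH)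
  then show ?case by simp
next
  case (Exists j \<phi>)
  have "sat M (s(j := a)) \<phi> = sat M (t(j := a)) \<phi>" for a
    using Exists.prems by (intro Exists.IH) auto
  then show ?case by simp
qed auto

text \<open>\<open>L\<close> holds the inspected facts, as pairs of an element and a predicate
  index, and \<open>Q\<close> the elements chosen by quantifiers. Under a quantifier an inspected
  element may also be the value of a variable that is still free; for a sentence this case vanishes
  and the elements of \<open>L\<close> all lie in \<open>Q\<close>.\<close>

definition sat_support :: "'a model \<Rightarrow> (nat \<Rightarrow> 'a) \<Rightarrow> fm \<Rightarrow> ('a \<times> nat) set \<Rightarrow> 'a set \<Rightarrow> bool" where
  "sat_support M s \<phi> L Q \<longleftrightarrow>
    finite L \<and> finite Q \<and> card L + card Q \<le> w \<phi> \<and> fst ` L \<subseteq> Q \<union> s ` free_vars \<phi> \<and>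
    (\<forall>M'. universe M' = universe M \<longrightarrow> (\<forall>(a, i) \<in> L. a \<in> interp M' i \<longleftrightarrow> a \<in> interp M i)
      \<longrightarrow> sat M' s \<phi>)"

text \<open>Negation occurs only at atoms, so a true literal depends on at most one fact. A
  disjunction inherits the support of a true disjunct, a conjunction takes unions, and a quantifier
  adds its witness to \<open>Q\<close>, which its weight 1 pays for.\<close>

lemma existential_sat_support:
  assumes "existential \<phi>" "sat M s \<phi>"
  shows "\<exists>L Q. sat_support M s \<phi> L Q"
  using assms
proof (induction \<phi> arbitrary: s)
  case (1 \<phi>)
  show ?case
  proof (cases \<phi>)
    case (Pred i j)
    then have "sat_support M s \<phi> {(s j, i)} {}" using 1 by (auto simp: sat_support_def)
    then show ?thesis by blast
  next
    case (Eq j k)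
    then have "sat_support M s \<phi> {} {}" using 1 by (auto simp: sat_support_def)
    then show ?thesis by blast
  qed (use 1 in auto)
next
  case (2 \<phi>)
  show ?case
  proof (cases \<phi>)
    case (Pred i j)
    then have "sat_support M s (Neg \<phi>) {(s j, i)} {}" using 2 by (auto simp: sat_support_def)
    then show ?thesis by blast
  next
    case (Eq j k)
    then have "sat_support M s (Neg \<phi>) {} {}" using 2 by (auto simp: sat_support_def)
    then show ?thesis by blast
  qed (use 2 in auto)
next
  case (3 \<phi> \<psi>)
  from "3.prems" consider "sat M s \<phi>" | "sat M s \<psi>" by auto
  then show ?case
  proof cases
    case 1
    then obtain L Q where "sat_support M s \<phi> L Q" using "3.IH"(1) by blast
    then have "sat_support M s (Or \<phi> \<psi>) L Q" by (auto simp: sat_support_def)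
    then show ?thesis by blast
  next
    case 2
    then obtain L Q where "sat_support M s \<psi> L Q" using "3.IH"(2) by blast
    then have "sat_support M s (Or \<phi> \<psi>) L Q" by (auto simp: sat_support_def)
    then show ?thesis by blast
  qed
next
  case (4 \<phi> \<psi>)
  from 4 obtain L Q where 1: "sat_support M s \<phi> L Q" by force
  from 4 obtain L' Q' where 2: "sat_support M s \<psi> L' Q'" by force
  have "card (L \<union> L') + card (Q \<union> Q') \<le> w (And \<phi> \<psi>)"
    using 1 2 card_Un_le[of L L'] card_Un_le[of Q Q'] by (simp add: sat_support_def)
  then have "sat_support M s (And \<phi> \<psi>) (L \<union> L') (Q \<union> Q')"
    using 1 2 by (auto simp: sat_support_def)
  then show ?case by blast
next
  case (5 \<phi> j)
  then obtain a where a: "a \<in> universe M" "sat M (s(j := a)) \<phi>" by auto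
  with "5.IH" obtain L Q where 1: "sat_support M (s(j := a)) \<phi> L Q" by blast
  have "card L + card (insert a Q) \<le> w (Exists j \<phi>)"
    using 1 by (simp add: sat_support_def card_insert_if)
  \<comment> \<open>Binding \<open>j\<close> removes it from the free variables; its value
    \<open>a\<close> under the updated assignment is now accounted for by
    \<open>insert a Q\<close>.\<close>
  moreover have "fst ` L \<subseteq> insert a Q \<union> s ` free_vars (Exists j \<phi>)"
  proof -
    have "fst ` L \<subseteq> Q \<union> (s(j := a)) ` free_vars \<phi>"
      using 1 unfolding sat_support_def by blast
    also have "\<dots> \<subseteq> insert a Q \<union> s ` free_vars (Exists j \<phi>)" by auto
    finally show ?thesis .
  qed
  \<comment> \<open>The old witness \<open>a\<close> still serves, because \<open>M'\<close> has the
    same universe.\<close>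
  moreover have "sat M' s (Exists j \<phi>)"
    if "universe M' = universe M" "\<forall>(b, i) \<in> L. b \<in> interp M' i \<longleftrightarrow> b \<in> interp M i" for M'
  proof -
    have "sat M' (s(j := a)) \<phi>" using 1 that unfolding sat_support_def by blast
    then show ?thesis using a(1) that(1) by auto
  qed
  ultimately have "sat_support M s (Exists j \<phi>) L (insert a Q)"
    using 1 unfolding sat_support_def by blast
  then show ?case by blast
qed

theorem corollary17:
  fixes n :: nat and \<phi> :: fm
  assumes "n \<ge> 1"
    and "infinite (UNIV :: 'a set)"
    and "sentence_over {1..n} \<phi>"
    and "existential \<phi>"
    and "expresses {1..n} \<phi> (all_boolean_combinations_nonempty n :: 'a model \<Rightarrow> bool)"
  shows "w \<phi> \<ge> (n + 1) * 2 ^ n"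
proof -
  \<comment> \<open>The elements of the model are indexed by the Boolean combinations:
    \<open>f S\<close> will be the only element realising \<open>S\<close>. An infinite type has
    room for these finitely many elements.\<close>
  obtain f :: "nat set \<Rightarrow> 'a" where f: "inj_on f (Pow {1..n})"
  proof -
    obtain g :: "nat set \<Rightarrow> nat" where "inj_on g (Pow {1..n})"
      using finite_imp_inj_to_nat_seg[of "Pow {1..n}"] by auto
    moreover obtain h :: "nat \<Rightarrow> 'a" where "inj h"
      using infinite_countable_subset[OF assms(2)] by blast
    ultimately have "inj_on (h \<circ> g) (Pow {1..n})"
      by (meson comp_inj_on inj_on_subset subset_UNIV)
    then show thesis by (rule that)
  qed
  define U where "U = f ` Pow {1..n}"
  define I where "I i = f ` {S. S \<subseteq> {1..n} \<and> i \<in> S}" for i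
  define M where "M = Model U I"
  have U: "U \<noteq> {}" "finite U" "card U = 2 ^ n"
    using card_image[OF f] by (auto simp: U_def card_Pow)
  have I: "f S \<in> I i \<longleftrightarrow> i \<in> S" if "S \<subseteq> {1..n}" for S i
    using that f by (auto simp: I_def inj_on_def)
  have indep: "sat N s \<phi> \<longleftrightarrow> sat N t \<phi>" for N :: "'a model" and s t
    using assms(3) by (intro sat_cong_free_vars) (auto simp: sentence_over_def)
  obtain u where "u \<in> U" using U by blast
  \<comment> \<open>Truth of a sentence does not depend on the assignment, so one fixed assignment
    into \<open>U\<close> can stand for all of them, in every model with universe
    \<open>U\<close>.\<close>
  define s where "s = (\<lambda>x :: nat. u)"
  have sat_iff: "sat N s \<phi> \<longleftrightarrow> all_boolean_combinations_nonempty n N"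
    if "is_model {1..n} N" "universe N = U" for N :: "'a model"
  proof -
    have "range s \<subseteq> universe N" using \<open>u \<in> U\<close> that(2) by (simp add: s_def)
    then have "true_in N \<phi> \<longleftrightarrow> sat N s \<phi>"
      unfolding true_in_def using indep[of N _ s] by metis
    then show ?thesis using assms(5) that(1) by (simp add: expresses_def)
  qed
  have "is_model {1..n} M" using U(1) by (auto simp: is_model_def M_def U_def I_def)
  moreover have "all_boolean_combinations_nonempty n M"
    using I by (auto simp: all_boolean_combinations_nonempty_def M_def U_def)
  ultimately have "sat M s \<phi>" using sat_iff by (simp add: M_def)
  then obtain L Q where "sat_support M s \<phi> L Q"
    using existential_sat_support[OF assms(4)] by blast
  then have fin: "finite L" "finite Q" and card: "card L + card Q \<le> w \<phi>"
    and LQ: "fst ` L \<subseteq> Q \<union> s ` free_vars \<phi>"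
    and supp: "\<And>M'. universe M' = universe M \<Longrightarrow>
      \<forall>(a, i) \<in> L. a \<in> interp M' i \<longleftrightarrow> a \<in> interp M i \<Longrightarrow> sat M' s \<phi>"
    by (auto simp: sat_support_def)
  have "fst ` L \<subseteq> Q" using LQ assms(3) by (simp add: sentence_over_def)
  have L: "U \<times> {1..n} \<subseteq> L"
  proof (rule ccontr)
    assume "\<not> U \<times> {1..n} \<subseteq> L"
    then obtain S i where S: "S \<subseteq> {1..n}" and i: "i \<in> {1..n}" and "(f S, i) \<notin> L"
      unfolding U_def by blast
    \<comment> \<open>\<open>J\<close> flips the single fact (\<open>f S\<close>, \<open>i\<close>).
      As this fact is outside \<open>L\<close>, the sentence stays true. Yet \<open>S\<close> is no
      longer realised: \<open>f S\<close> is now wrong at \<open>i\<close>, and every other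
      \<open>f T\<close> still realises \<open>T\<close>.\<close>
    define J where "J = I(i := if i \<in> S then I i - {f S} else insert (f S) (I i))"
    have J: "a \<in> J k \<longleftrightarrow> (if (a, k) = (f S, i) then i \<notin> S else a \<in> I k)" for a k
      by (auto simp: J_def)
    have "is_model {1..n} (Model U J)"
      using U(1) S by (auto simp: is_model_def J_def U_def I_def)
    moreover have "sat (Model U J) s \<phi>"
      using \<open>(f S, i) \<notin> L\<close> by (intro supp) (auto simp: M_def J)
    ultimately have "all_boolean_combinations_nonempty n (Model U J)"
      using sat_iff by simp
    then have "\<exists>x\<in>U. \<forall>k\<in>{1..n}. x \<in> J k \<longleftrightarrow> k \<in> S"
      using S unfolding all_boolean_combinations_nonempty_def by simp
    then obtain T where T: "T \<subseteq> {1..n}" "\<And>k. k \<in> {1..n} \<Longrightarrow> f T \<in> J k \<longleftrightarrow> k \<in> S"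
      unfolding U_def by blast
    show False
    proof (cases "T = S")
      case True
      then show False using T(2)[OF i] by (simp add: J)
    next
      case False
      then have "f T \<noteq> f S" using inj_onD[OF f, of T S] S T(1) by blast
      then have "k \<in> T \<longleftrightarrow> k \<in> S" if "k \<in> {1..n}" for k
        using T(2)[OF that] I[OF T(1)] by (simp add: J)
      then show False using S T(1) False by blast
    qed
  qed
  have "U \<subseteq> Q"
  proof
    fix a assume "a \<in> U"
    \<comment> \<open>Since \<open>n\<close> is at least 1, the index 1 is available, so every
      element of \<open>U\<close> occurs in some inspected fact.\<close>
    then have "(a, 1) \<in> L" using L assms(1) by auto
    then show "a \<in> Q" using \<open>fst ` L \<subseteq> Q\<close> by force
  qed
  then have "2 ^ n \<le> card Q" using card_mono fin(2) U(3) by metis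
  moreover have "n * 2 ^ n \<le> card L"
    using card_mono[OF fin(1) L] U(3) by (simp add: card_cartesian_product mult.commute)
  ultimately show ?thesis using card by (simp add: algebra_simps)
qed

end
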